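(* Fix positive integers $d,r$, reals $\ell>0$, $q>0$, $\delta\in(0,1)$ and $\phi\in(0,1/2)$. For each $n$, let $\mathcal{D}=\mathcal{D}_n$ be a distribution of mean-zero sub-Gaussian random vectors in $\mathbb{R}^n$ with sub-Gaussian norm bounded by $\ell$, whose coordinates are independent random variables that are bounded away from zero: each coordinate has absolute value $>q$ almost surely. Let $\mathbf{A}=\mathbf{A}_1\bullet\mathbf{A}_2\bullet\cdots\bullet\mathbf{A}_d\in\mathbb{R}^{m\times n^d}$ be the random measurement matrix where $\mathbf{A}_1,\dots,\mathbf{A}_d\in\mathbb{R}^{m\times n}$ are random matrices whose rows are sampled independently from $\mathcal{D}_n$ (for different $m$, the matrices are formed from the first $m$ terms of the same i.i.d. sequences of rows). Then $$\lim_{n\to\infty}\mathbb{P}\left(\alpha_n\mathbf{A}\ \text{satisfies}\ (\delta,r)\text{-TensorRIP for some } m<n^{d(1-\phi)}\ \text{and some}\ \alpha_n\in\mathbb{R}^+\right)=0.$$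
   Context: Face-splitting product: for matrices $\mathbf{A}_i\in\mathbb{R}^{m\times n_i}$, $\mathbf{A}_1\bullet\cdots\bullet\mathbf{A}_d\in\mathbb{R}^{m\times n_1\cdots n_d}$ is the matrix whose $j$-th row is the Kronecker product $\mathbf a_{1j}^T\otimes\cdots\otimes\mathbf a_{dj}^T$ of the $j$-th rows of the $\mathbf{A}_i$. $\mathrm{Vec}:\mathbb{R}^{n\times\cdots\times n}\to\mathbb{R}^{n^d}$ sends the entry with index $(i_1,\dots,i_d)$ to coordinate $1+\sum_{j=1}^d(i_j-1)n^{d-j}$, and $\|\mathcal{X}\|_F=\|\mathrm{Vec}(\mathcal{X})\|_2$. A tensor $\mathcal{X}\in\mathbb{R}^{n\times\cdots\times n}$ ($d$ modes) has CP rank at most $r$ if it is a sum of $r$ outer products $\mathbf x_1\circ\cdots\circ\mathbf x_d$ with $\mathbf x_i\in\mathbb{R}^n$. A matrix $\mathbf M\in\mathbb{R}^{m\times n^d}$ satisfies $(\delta,r)$-TensorRIP if $(1-\delta)\|\mathcal{X}\|_F^2\le\|\mathbf M\,\mathrm{Vec}(\mathcal{X})\|_2^2\le(1+\delta)\|\mathcal{X}\|_F^2$ for every $\mathcal{X}$ with $\|\mathcal{X}\|_F=1$ and CP rank at most $r$. The sub-Gaussian norm of a random variable $X$ is $\|X\|_{\psi_2}=\inf\{t>0:\mathbb{E}\exp(X^2/t^2)\le 2\}$; the sub-Gaussian norm of a random vector is the supremum of the sub-Gaussian norms of its inner products with unit vectors. *)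

theory Defs
  imports "HOL-Probability.Probability" "Jordan_Normal_Form.Matrix"
begin

text \<open>All dimensions vary with \<open>n\<close>, so vectors and matrices are those of
  \<open>Jordan_Normal_Form.Matrix\<close>, indexed from 0.  The qualified names avoid the
  type-indexed namesakes from \<open>HOL-Analysis\<close>.\<close>

no_notation vec_nth (infixl \<open>$\<close> 90)

section \<open>Kronecker and face-splitting products\<close>

definition kron_vec :: "real Matrix.vec \<Rightarrow> real Matrix.vec \<Rightarrow> real Matrix.vec" where
  "kron_vec u v =
     Matrix.vec (dim_vec u * dim_vec v) (\<lambda>c. u $ (c div dim_vec v) * v $ (c mod dim_vec v))"

definition kron_list :: "real Matrix.vec list \<Rightarrow> real Matrix.vec" where
  "kron_list us = foldr kron_vec us (Matrix.vec 1 (\<lambda>_. 1))"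

text \<open>Only used for nonempty lists of matrices with the same number of rows.\<close>

definition face_splitting :: "real Matrix.mat list \<Rightarrow> real Matrix.mat" where
  "face_splitting As =
     mat_of_rows (prod_list (map dim_col As))
       (map (\<lambda>j. kron_list (map (\<lambda>A. Matrix.row A j) As)) [0..<dim_row (hd As)])"

section \<open>Tensors with \<open>d\<close> modes of size \<open>n\<close>\<close>

text \<open>A tensor is a function on multi-indices; only its values on \<open>multi_indices n d\<close> matter.\<close>

type_synonym tensor = "nat list \<Rightarrow> real"

definition multi_indices :: "nat \<Rightarrow> nat \<Rightarrow> nat list set" where
  "multi_indices n d = {is. length is = d \<and> set is \<subseteq> {..<n}}"

text \<open>Zero-based form of the coordinate $1 + \sum_{j=1}^d (i_j - 1) n^{d-j}$.\<close>

definition flat_index :: "nat \<Rightarrow> nat list \<Rightarrow> nat" where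
  "flat_index n is = (\<Sum>j<length is. is ! j * n ^ (length is - 1 - j))"

definition tensor_vec :: "nat \<Rightarrow> nat \<Rightarrow> tensor \<Rightarrow> real Matrix.vec" where
  "tensor_vec n d X =
     Matrix.vec (n ^ d) (\<lambda>c. X (the_inv_into (multi_indices n d) (flat_index n) c))"

definition l2_norm :: "real Matrix.vec \<Rightarrow> real" where
  "l2_norm v = L2_set (\<lambda>i. v $ i) {..<dim_vec v}"

definition frob_norm :: "nat \<Rightarrow> nat \<Rightarrow> tensor \<Rightarrow> real" where
  "frob_norm n d X = l2_norm (tensor_vec n d X)"

definition outer_product :: "real Matrix.vec list \<Rightarrow> tensor" where
  "outer_product xs is = (\<Prod>j<length xs. (xs ! j) $ (is ! j))"

definition cp_rank_le :: "nat \<Rightarrow> nat \<Rightarrow> nat \<Rightarrow> tensor \<Rightarrow> bool" where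
  "cp_rank_le r n d X \<longleftrightarrow>
     (\<exists>xs. (\<forall>k<r. length (xs k) = d \<and> set (xs k) \<subseteq> carrier_vec n) \<and>
       (\<forall>is\<in>multi_indices n d. X is = (\<Sum>k<r. outer_product (xs k) is)))"

definition tensor_rip :: "real \<Rightarrow> nat \<Rightarrow> nat \<Rightarrow> nat \<Rightarrow> real Matrix.mat \<Rightarrow> bool" where
  "tensor_rip \<delta> r n d A \<longleftrightarrow>
     (\<forall>X. frob_norm n d X = 1 \<longrightarrow> cp_rank_le r n d X \<longrightarrow>
        (1 - \<delta>) * (frob_norm n d X)\<^sup>2 \<le> (l2_norm (A *\<^sub>v tensor_vec n d X))\<^sup>2 \<and>
        (l2_norm (A *\<^sub>v tensor_vec n d X))\<^sup>2 \<le> (1 + \<delta>) * (frob_norm n d X)\<^sup>2)"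

lemma flat_index_Cons:
  "flat_index n (i # is) = i * n ^ length is + flat_index n is"
  unfolding flat_index_def
  by (simp add: sum.lessThan_Suc_shift del: sum.lessThan_Suc)

lemma multi_indices_Suc:
  "multi_indices n (Suc d) = (\<lambda>(i, is). i # is) ` ({..<n} \<times> multi_indices n d)"
  unfolding multi_indices_def by (auto simp: length_Suc_conv image_iff)

lemma flat_index_less: "is \<in> multi_indices n d \<Longrightarrow> flat_index n is < n ^ d"
proof (induction d arbitrary: "is")
  case 0
  then show ?case by (simp add: multi_indices_def flat_index_def)
next
  case (Suc d)
  then obtain i js where js: "is = i # js" "i < n" "js \<in> multi_indices n d"
    by (auto simp: multi_indices_Suc)
  have "flat_index n is < i * n ^ d + n ^ d"
    using Suc.IH[OF js(3)] js by (simp add: flat_index_Cons multi_indices_def)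
  also have "\<dots> = Suc i * n ^ d" by simp
  also have "\<dots> \<le> n * n ^ d" using js(2) by (intro mult_right_mono) auto
  finally show ?case by simp
qed

lemma flat_index_Cons_div_mod:
  assumes "is \<in> multi_indices n d"
  shows "flat_index n (i # is) div n ^ d = i" "flat_index n (i # is) mod n ^ d = flat_index n is"
proof -
  have "length is = d" "flat_index n is < n ^ d"
    using assms flat_index_less by (auto simp: multi_indices_def)
  then show "flat_index n (i # is) div n ^ d = i"
    and "flat_index n (i # is) mod n ^ d = flat_index n is"
    by (auto simp: flat_index_Cons div_mult_self3 intro: div_nat_eqI)
qed

lemma inj_on_flat_index: "inj_on (flat_index n) (multi_indices n d)"
proof (induction d)
  case 0
  then show ?case by (simp add: multi_indices_def inj_on_def)
next
  case (Suc d)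
  show ?case
  proof (rule inj_onI)
    fix is1 is2
    assume "is1 \<in> multi_indices n (Suc d)" "is2 \<in> multi_indices n (Suc d)"
      and eq: "flat_index n is1 = flat_index n is2"
    then obtain i js k ks where
      *: "is1 = i # js" "js \<in> multi_indices n d" "is2 = k # ks" "ks \<in> multi_indices n d"
      by (auto simp: multi_indices_Suc)
    with eq have "i = k" "flat_index n js = flat_index n ks"
      using flat_index_Cons_div_mod by metis+
    with * Suc show "is1 = is2" by (auto dest: inj_onD)
  qed
qed

lemma bij_betw_flat_index: "bij_betw (flat_index n) (multi_indices n d) {..<n ^ d}"
proof -
  have "card (multi_indices n d) = n ^ d"
    using card_lists_length_eq[of "{..<n}" d] by (simp add: multi_indices_def conj_commute)
  then have "card (flat_index n ` multi_indices n d) = card {..<n ^ d}"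
    by (simp add: card_image inj_on_flat_index)
  then have "flat_index n ` multi_indices n d = {..<n ^ d}"
    by (intro card_subset_eq) (auto simp: flat_index_less)
  then show ?thesis
    by (simp add: bij_betw_def inj_on_flat_index)
qed

lemma tensor_vec_index:
  "is \<in> multi_indices n d \<Longrightarrow> tensor_vec n d X $ flat_index n is = X is"
  by (simp add: tensor_vec_def flat_index_less the_inv_into_f_f inj_on_flat_index)

text \<open>The ordering of coordinates in \<open>kron_list\<close> agrees with that of \<open>tensor_vec\<close>.\<close>

lemma kron_list_dim: "set xs \<subseteq> carrier_vec n \<Longrightarrow> dim_vec (kron_list xs) = n ^ length xs"
  by (induction xs) (auto simp: kron_list_def kron_vec_def)

lemma kron_list_index:
  assumes "is \<in> multi_indices n d" "length xs = d" "set xs \<subseteq> carrier_vec n"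
  shows "kron_list xs $ flat_index n is = outer_product xs is"
  using assms
proof (induction d arbitrary: "is" xs)
  case 0
  then show ?case
    by (simp add: multi_indices_def kron_list_def flat_index_def outer_product_def)
next
  case (Suc d)
  from Suc.prems obtain i js where js: "is = i # js" "i < n" "js \<in> multi_indices n d"
    by (auto simp: multi_indices_Suc)
  from Suc.prems obtain y ys where ys: "xs = y # ys" "length ys = d" "set ys \<subseteq> carrier_vec n"
    "dim_vec y = n"
    by (cases xs) auto
  have dim: "dim_vec (kron_list ys) = n ^ d" using kron_list_dim ys by metis
  have "kron_list xs = kron_vec y (kron_list ys)" by (simp add: ys kron_list_def)
  moreover have "flat_index n is < n * n ^ d"
    using flat_index_less[OF Suc.prems(1)] by simp
  ultimately have "kron_list xs $ flat_index n is = y $ i * kron_list ys $ flat_index n js"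
    using flat_index_Cons_div_mod[OF js(3)] by (simp add: kron_vec_def dim ys js)
  also have "\<dots> = outer_product xs is"
    unfolding outer_product_def
    using Suc.IH[OF js(3) ys(2,3)]
    by (simp add: ys js outer_product_def prod.lessThan_Suc_shift del: prod.lessThan_Suc)
  finally show ?case .
qed

lemma tensor_vec_outer_product:
  assumes "length xs = d" "set xs \<subseteq> carrier_vec n"
  shows "tensor_vec n d (outer_product xs) = kron_list xs"
proof (rule eq_vecI)
  fix c assume "c < dim_vec (kron_list xs)"
  then have "c \<in> flat_index n ` multi_indices n d"
    using assms kron_list_dim bij_betw_flat_index[of n d] by (simp add: bij_betw_def)
  then show "tensor_vec n d (outer_product xs) $ c = kron_list xs $ c"
    using tensor_vec_index kron_list_index assms by auto
qed (use assms kron_list_dim in \<open>simp add: tensor_vec_def\<close>)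

section \<open>Sub-Gaussian random vectors\<close>

text \<open>Values in \<^typ>\<open>ennreal\<close>: the infimum is \<open>\<infinity>\<close> if no admissible \<open>t\<close> exists.\<close>

definition subgaussian_norm :: "'a measure \<Rightarrow> ('a \<Rightarrow> real) \<Rightarrow> ennreal" where
  "subgaussian_norm M X =
     Inf {ennreal t | t. t > 0 \<and> (\<integral>\<^sup>+\<omega>. ennreal (exp ((X \<omega>)\<^sup>2 / t\<^sup>2)) \<partial>M) \<le> 2}"

text \<open>Random rows are elements of the product measurable space \<open>borel_vec n\<close>, i.e. extensional
  functions on \<open>{..<n}\<close>.\<close>

abbreviation borel_vec :: "nat \<Rightarrow> (nat \<Rightarrow> real) measure" where
  "borel_vec n \<equiv> Pi\<^sub>M {..<n} (\<lambda>_. borel)"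

definition subgaussian_norm_vec :: "nat \<Rightarrow> (nat \<Rightarrow> real) measure \<Rightarrow> ennreal" where
  "subgaussian_norm_vec n D =
     (SUP u \<in> {u. L2_set u {..<n} = 1}. subgaussian_norm D (\<lambda>x. \<Sum>i<n. x i * u i))"

definition admissible_distribution ::
  "real \<Rightarrow> real \<Rightarrow> nat \<Rightarrow> (nat \<Rightarrow> real) measure \<Rightarrow> bool" where
  "admissible_distribution l q n D \<longleftrightarrow>
     prob_space D \<and> sets D = sets (borel_vec n) \<and>
     (\<forall>i<n. integrable D (\<lambda>x. x i) \<and> (\<integral>x. x i \<partial>D) = 0) \<and>
     subgaussian_norm_vec n D \<le> ennreal l \<and>
     prob_space.indep_vars D (\<lambda>_. borel) (\<lambda>i x. x i) {..<n} \<and>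
     (\<forall>i<n. AE x in D. \<bar>x i\<bar> > q)"

section \<open>The random measurement matrix\<close>

text \<open>\<open>a i k\<close> is the \<open>k\<close>-th row of the \<open>i\<close>-th factor; all rows of all factors are jointly
  independent, and for every \<open>m\<close> the factors use the first \<open>m\<close> rows of the same sequences.\<close>

definition iid_rows ::
  "nat \<Rightarrow> nat \<Rightarrow> 'a measure \<Rightarrow> (nat \<Rightarrow> real) measure \<Rightarrow> (nat \<Rightarrow> nat \<Rightarrow> 'a \<Rightarrow> nat \<Rightarrow> real) \<Rightarrow> bool" where
  "iid_rows d n M D a \<longleftrightarrow>
     prob_space.indep_vars M (\<lambda>_. borel_vec n) (\<lambda>(i, k). a i k) ({..<d} \<times> UNIV) \<and>
     (\<forall>i<d. \<forall>k. distr M (borel_vec n) (a i k) = D)"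

definition factor_matrix :: "nat \<Rightarrow> nat \<Rightarrow> (nat \<Rightarrow> nat \<Rightarrow> real) \<Rightarrow> real Matrix.mat" where
  "factor_matrix n m b = Matrix.mat m n (\<lambda>(k, c). b k c)"

definition measurement_matrix ::
  "nat \<Rightarrow> nat \<Rightarrow> nat \<Rightarrow> (nat \<Rightarrow> nat \<Rightarrow> 'a \<Rightarrow> nat \<Rightarrow> real) \<Rightarrow> 'a \<Rightarrow> real Matrix.mat" where
  "measurement_matrix d n m a \<omega> =
     face_splitting (map (\<lambda>i. factor_matrix n m (\<lambda>k. a i k \<omega>)) [0..<d])"

end

theory Submission
  imports Defs
begin

text \<open>Rank-one tensors suffice.  Aligning the test tensor with the first rows of the factors gives
  \<open>\<alpha>\<^sup>2 (q\<^sup>2 n)\<^sup>d \<le> 1 + \<delta>\<close>, while a coordinate tensor gives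
  \<open>1 - \<delta> \<le> \<alpha>\<^sup>2 (\<Sum>j<m. \<Prod>i<d. (a\<^sub>i\<^sub>j\<^sub>c)\<^sup>2)\<close>.  Hence that sum, which increases with \<open>m\<close>, is at
  least of order \<open>n\<^sup>d\<close>.  Its expectation is \<open>O(m)\<close>, so Markov's inequality for the largest
  admissible \<open>m\<close> bounds the probability by \<open>O(n powr (- d \<phi>))\<close>.\<close>

section \<open>Scalar products of Kronecker products\<close>

lemma l2_norm_power2: "(l2_norm v)\<^sup>2 = scalar_prod v v"
  unfolding l2_norm_def L2_set_def scalar_prod_def
  by (simp add: sum_nonneg power2_eq_square atLeast0LessThan)

text \<open>The coordinates fall into consecutive blocks of length \<open>dim_vec z\<close>. On the
  i-th block the first factors are constant and the second factors run through all their
  coordinates, so each block contributes u_i w_i times the scalar product of \<open>v\<close> and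
  \<open>z\<close>.\<close>

lemma scalar_prod_kron_vec:
  assumes "dim_vec u = dim_vec w" "dim_vec v = dim_vec z"
  shows "scalar_prod (kron_vec u v) (kron_vec w z) = scalar_prod u w * scalar_prod v z"
proof -
  let ?a = "dim_vec w" and ?b = "dim_vec z"
  let ?g = "\<lambda>c. (u $ (c div ?b) * v $ (c mod ?b)) * (w $ (c div ?b) * z $ (c mod ?b))"
  have inner: "sum ?g {i * ?b..<i * ?b + ?b} = u $ i * w $ i * scalar_prod v z" for i
  proof -
    have "sum ?g {i * ?b..<i * ?b + ?b} = (\<Sum>k<?b. ?g (k + i * ?b))"
      using sum.shift_bounds_nat_ivl[of ?g 0 "i * ?b" ?b]
      by (simp add: add.commute atLeast0LessThan)
    also have "\<dots> = (\<Sum>k<?b. u $ i * w $ i * (v $ k * z $ k))"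
    proof (intro sum.cong refl)
      fix k assume "k \<in> {..<?b}"
      then have "(k + i * ?b) div ?b = i" "(k + i * ?b) mod ?b = k"
        by (cases "?b = 0"; simp)+
      then show "?g (k + i * ?b) = u $ i * w $ i * (v $ k * z $ k)"
        by (simp only: mult_ac)
    qed
    finally show ?thesis
      by (simp add: scalar_prod_def sum_distrib_left atLeast0LessThan)
  qed
  have "scalar_prod (kron_vec u v) (kron_vec w z) = sum ?g {..<?a * ?b}"
    using assms unfolding scalar_prod_def kron_vec_def atLeast0LessThan
    by (auto intro!: sum.cong)
  also have "\<dots> = (\<Sum>i<?a. u $ i * w $ i * scalar_prod v z)"
    by (subst sum.nat_group[symmetric]) (simp add: inner)
  finally show ?thesis
    by (simp add: scalar_prod_def[of u w] sum_distrib_right atLeast0LessThan)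
qed

lemma kron_list_carrier: "set xs \<subseteq> carrier_vec n \<Longrightarrow> kron_list xs \<in> carrier_vec (n ^ length xs)"
  by (intro carrier_vecI kron_list_dim)

lemma scalar_prod_kron_list:
  assumes "length us = length vs" "set us \<subseteq> carrier_vec n" "set vs \<subseteq> carrier_vec n"
  shows "scalar_prod (kron_list us) (kron_list vs) =
    (\<Prod>i<length us. scalar_prod (us ! i) (vs ! i))"
  using assms
proof (induction us vs rule: list_induct2)
  case Nil
  then show ?case by (simp add: kron_list_def scalar_prod_def)
next
  case (Cons u us v vs)
  have "scalar_prod (kron_list (u # us)) (kron_list (v # vs)) =
      scalar_prod (kron_vec u (kron_list us)) (kron_vec v (kron_list vs))"
    by (simp add: kron_list_def)
  also have "\<dots> = scalar_prod u v * scalar_prod (kron_list us) (kron_list vs)"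
  proof (rule scalar_prod_kron_vec)
    show "dim_vec u = dim_vec v"
      using Cons.prems by auto
    show "dim_vec (kron_list us) = dim_vec (kron_list vs)"
      using Cons.prems Cons.hyps kron_list_dim[of us n] kron_list_dim[of vs n] by simp
  qed
  also have "scalar_prod (kron_list us) (kron_list vs) =
      (\<Prod>i<length us. scalar_prod (us ! i) (vs ! i))"
    using Cons.prems by (intro Cons.IH) auto
  finally show ?case
    by (simp add: prod.lessThan_Suc_shift del: prod.lessThan_Suc)
qed

section \<open>Rank-one tensors as test tensors\<close>

text \<open>One outer product is padded to \<open>r\<close> summands by outer products of zero
  vectors. These vanish because \<open>d > 0\<close>; for \<open>d = 0\<close> the empty product
  would be 1.\<close>

lemma cp_rank_le_outer_product:
  assumes "d > 0" "r > 0" "length xs = d" "set xs \<subseteq> carrier_vec n"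
  shows "cp_rank_le r n d (outer_product xs)"
  unfolding cp_rank_le_def
proof (intro exI[of _ "\<lambda>k. if k = 0 then xs else replicate d (0\<^sub>v n)"] conjI ballI allI impI)
  fix "is" assume "is": "is \<in> multi_indices n d"
  then have "is ! 0 < n"
    using \<open>d > 0\<close> by (auto simp: multi_indices_def subset_iff)
  then have zero: "outer_product (replicate d (0\<^sub>v n)) is = 0"
    using \<open>d > 0\<close> unfolding outer_product_def by (auto intro!: prod_zero bexI[of _ 0])
  have "(\<Sum>k<r. outer_product (if k = 0 then xs else replicate d (0\<^sub>v n)) is) =
      (\<Sum>k<r. if k = 0 then outer_product xs is else 0)"
    by (intro sum.cong) (auto simp: zero)
  then show "outer_product xs is =
      (\<Sum>k<r. outer_product (if k = 0 then xs else replicate d (0\<^sub>v n)) is)"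
    using \<open>r > 0\<close> by simp
qed (use assms in auto)

text \<open>Scalar products of Kronecker products factor over the modes, so unit factors give a
  rank-one tensor of Frobenius norm 1, to which both sides of the RIP apply.\<close>

lemma tensor_rip_kron_list:
  assumes "tensor_rip \<delta> r n d A" "d > 0" "r > 0"
    and "length xs = d" "set xs \<subseteq> carrier_vec n" "\<And>i. i < d \<Longrightarrow> scalar_prod (xs ! i) (xs ! i) = 1"
  shows "1 - \<delta> \<le> (l2_norm (A *\<^sub>v kron_list xs))\<^sup>2"
    and "(l2_norm (A *\<^sub>v kron_list xs))\<^sup>2 \<le> 1 + \<delta>"
proof -
  have vec: "tensor_vec n d (outer_product xs) = kron_list xs"
    using assms tensor_vec_outer_product by blast
  have "(l2_norm (kron_list xs))\<^sup>2 = 1"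
    using assms by (simp add: l2_norm_power2 scalar_prod_kron_list)
  \<comment> \<open>Nonnegativity rules out -1 as the value whose square is 1.\<close>
  moreover have "l2_norm (kron_list xs) \<ge> 0"
    by (simp add: l2_norm_def)
  ultimately have "frob_norm n d (outer_product xs) = 1"
    by (simp add: frob_norm_def vec power2_eq_1_iff)
  with assms(1) cp_rank_le_outer_product[OF assms(2-5)]
  show "1 - \<delta> \<le> (l2_norm (A *\<^sub>v kron_list xs))\<^sup>2" "(l2_norm (A *\<^sub>v kron_list xs))\<^sup>2 \<le> 1 + \<delta>"
    unfolding tensor_rip_def by (auto simp flip: vec)
qed

section \<open>The measurement matrix applied to rank-one tensors\<close>

lemma dim_row_measurement_matrix:
  "d > 0 \<Longrightarrow> dim_row (measurement_matrix d n m a \<omega>) = m"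
  by (simp add: measurement_matrix_def face_splitting_def factor_matrix_def hd_map)

lemma dim_col_measurement_matrix: "dim_col (measurement_matrix d n m a \<omega>) = n ^ d"
proof -
  have "map (dim_col \<circ> (\<lambda>i. factor_matrix n m (\<lambda>k. a i k \<omega>))) [0..<d] = replicate d n"
    by (intro nth_equalityI) (auto simp: factor_matrix_def)
  then show ?thesis
    by (simp add: measurement_matrix_def face_splitting_def)
qed

lemma row_measurement_matrix:
  assumes "d > 0" "j < m"
  shows "Matrix.row (measurement_matrix d n m a \<omega>) j =
    kron_list (map (\<lambda>i. Matrix.vec n (a i j \<omega>)) [0..<d])"
proof -
  let ?As = "map (\<lambda>i. factor_matrix n m (\<lambda>k. a i k \<omega>)) [0..<d]"
  let ?xs = "map (\<lambda>i. Matrix.vec n (a i j \<omega>)) [0..<d]"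
  have rows: "map (\<lambda>A. Matrix.row A j) ?As = ?xs"
    using assms by (auto simp: factor_matrix_def)
  have "prod_list (map dim_col ?As) = n ^ d"
    using dim_col_measurement_matrix[of d n m a \<omega>]
    by (simp add: measurement_matrix_def face_splitting_def)
  moreover have "dim_row (hd ?As) = m"
    using assms by (simp add: factor_matrix_def hd_map)
  moreover have "kron_list ?xs \<in> carrier_vec (n ^ d)"
    using kron_list_carrier[of ?xs n] by (simp add: image_subset_iff)
  ultimately show ?thesis
    using assms rows unfolding measurement_matrix_def face_splitting_def
    by (subst mat_of_rows_row) (auto simp del: map_map)
qed

text \<open>Each row of the matrix is itself a Kronecker product, so its scalar product with a
  rank-one tensor splits into \<open>d\<close> scalar products in dimension
  \<open>n\<close>.\<close>

lemma l2_norm_measurement_kron_list: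
  assumes "d > 0" "length xs = d" "set xs \<subseteq> carrier_vec n"
  shows "(l2_norm ((\<alpha> \<cdot>\<^sub>m measurement_matrix d n m a \<omega>) *\<^sub>v kron_list xs))\<^sup>2 =
    \<alpha>\<^sup>2 * (\<Sum>j<m. \<Prod>i<d. (scalar_prod (Matrix.vec n (a i j \<omega>)) (xs ! i))\<^sup>2)"
proof -
  let ?A = "measurement_matrix d n m a \<omega>"
  have entry: "((\<alpha> \<cdot>\<^sub>m ?A) *\<^sub>v kron_list xs) $ j =
      \<alpha> * (\<Prod>i<d. scalar_prod (Matrix.vec n (a i j \<omega>)) (xs ! i))" if "j < m" for j
  proof -
    have row: "Matrix.row (\<alpha> \<cdot>\<^sub>m ?A) j = \<alpha> \<cdot>\<^sub>v Matrix.row ?A j"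
      using that assms by (simp add: dim_row_measurement_matrix)
    have "((\<alpha> \<cdot>\<^sub>m ?A) *\<^sub>v kron_list xs) $ j = scalar_prod (\<alpha> \<cdot>\<^sub>v Matrix.row ?A j) (kron_list xs)"
      using that assms by (simp add: dim_row_measurement_matrix row)
    also have "\<dots> = \<alpha> * scalar_prod (Matrix.row ?A j) (kron_list xs)"
    proof (rule smult_scalar_prod_distrib)
      show "Matrix.row ?A j \<in> carrier_vec (n ^ d)"
        by (rule row_carrier[of ?A, unfolded dim_col_measurement_matrix])
      show "kron_list xs \<in> carrier_vec (n ^ d)"
        using kron_list_carrier assms by blast
    qed
    also have "scalar_prod (Matrix.row ?A j) (kron_list xs) =
        (\<Prod>i<d. scalar_prod (Matrix.vec n (a i j \<omega>)) (xs ! i))"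
      using assms that by (simp add: row_measurement_matrix scalar_prod_kron_list[of _ _ n] image_subset_iff)
    finally show ?thesis .
  qed
  have "(l2_norm ((\<alpha> \<cdot>\<^sub>m ?A) *\<^sub>v kron_list xs))\<^sup>2 =
      (\<Sum>j<m. (((\<alpha> \<cdot>\<^sub>m ?A) *\<^sub>v kron_list xs) $ j)\<^sup>2)"
    unfolding l2_norm_power2 scalar_prod_def
    using assms by (simp add: dim_row_measurement_matrix
      power2_eq_square atLeast0LessThan del: index_mult_mat_vec)
  then show ?thesis
    by (simp add: entry power_mult_distrib prod_power_distrib sum_distrib_left del: index_mult_mat_vec)
qed

section \<open>Deterministic consequence of the RIP\<close>

text \<open>The scale \<alpha> is unknown, but it enters both tests through the same factor
  \<alpha>^2. Comparing the lower RIP bound at a coordinate tensor with the upper one at the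
  normalised first rows eliminates it.\<close>

lemma tensor_rip_measurement_matrix_lower_bound:
  fixes a :: "nat \<Rightarrow> nat \<Rightarrow> 'a \<Rightarrow> nat \<Rightarrow> real"
  assumes rip: "tensor_rip \<delta> r n d (\<alpha> \<cdot>\<^sub>m measurement_matrix d n m a \<omega>)"
    and "d > 0" "r > 0" "0 < \<delta>" "\<delta> < 1" "q > 0" "\<alpha> > 0" "c < n"
    and bound: "\<And>i k. i < d \<Longrightarrow> k < n \<Longrightarrow> \<bar>a i 0 \<omega> k\<bar> > q"
  shows "(1 - \<delta>) / (1 + \<delta>) * (q\<^sup>2 * real n) ^ d \<le> (\<Sum>j<m. \<Prod>i<d. (a i j \<omega> c)\<^sup>2)"
proof -
  define xs where "xs = replicate d (unit_vec n c :: real Matrix.vec)"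
  have xs: "length xs = d" "set xs \<subseteq> carrier_vec n" "\<And>i. i < d \<Longrightarrow> scalar_prod (xs ! i) (xs ! i) = 1"
    using \<open>c < n\<close> by (auto simp: xs_def)
  have "1 - \<delta> \<le> (l2_norm ((\<alpha> \<cdot>\<^sub>m measurement_matrix d n m a \<omega>) *\<^sub>v kron_list xs))\<^sup>2"
    by (rule tensor_rip_kron_list(1)[OF rip \<open>d > 0\<close> \<open>r > 0\<close> xs])
  also have "\<dots> = \<alpha>\<^sup>2 * (\<Sum>j<m. \<Prod>i<d. (scalar_prod (Matrix.vec n (a i j \<omega>)) (xs ! i))\<^sup>2)"
    by (rule l2_norm_measurement_kron_list[OF \<open>d > 0\<close> xs(1,2)])
  also have "\<dots> = \<alpha>\<^sup>2 * (\<Sum>j<m. \<Prod>i<d. (a i j \<omega> c)\<^sup>2)"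
    using \<open>c < n\<close> by (auto simp: xs_def)
  finally have lower: "1 - \<delta> \<le> \<alpha>\<^sup>2 * (\<Sum>j<m. \<Prod>i<d. (a i j \<omega> c)\<^sup>2)" .
  \<comment> \<open>With no rows the right side of \<open>lower\<close> would be 0. Hence row 0,
    used for the second test tensor, exists.\<close>
  then have "m > 0"
    using \<open>\<delta> < 1\<close> by (cases m) auto
  define s where "s i = scalar_prod (Matrix.vec n (a i 0 \<omega>)) (Matrix.vec n (a i 0 \<omega>))" for i
  have s: "s i \<ge> q\<^sup>2 * real n" if "i < d" for i
  proof -
    have "q\<^sup>2 \<le> (a i 0 \<omega> k)\<^sup>2" if "k < n" for k
      using bound[OF \<open>i < d\<close> that] \<open>q > 0\<close> by (simp add: abs_le_square_iff[symmetric])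
    then have "(\<Sum>k<n. q\<^sup>2) \<le> (\<Sum>k<n. (a i 0 \<omega> k)\<^sup>2)"
      by (intro sum_mono) auto
    then show ?thesis
      by (simp add: s_def scalar_prod_def power2_eq_square atLeast0LessThan mult.commute)
  qed
  have "q\<^sup>2 * real n > 0"
    using \<open>q > 0\<close> \<open>c < n\<close> by simp
  \<comment> \<open>The first rows are therefore nonzero and can be normalised.\<close>
  then have s_pos: "s i > 0" if "i < d" for i
    using s[OF that] by linarith
  \<comment> \<open>The first row of each factor divided by its norm, \<open>sqrt (s i)\<close>. Its
    scalar product with that row is the norm again, so the squared response of row 0 is the product
    of the \<open>s i\<close>.\<close>
  define ys where "ys = map (\<lambda>i. (1 / sqrt (s i)) \<cdot>\<^sub>v Matrix.vec n (a i 0 \<omega>)) [0..<d]"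
  have ys: "length ys = d" "set ys \<subseteq> carrier_vec n"
    by (auto simp: ys_def)
  have row_ys: "scalar_prod (Matrix.vec n (a i 0 \<omega>)) (ys ! i) = sqrt (s i)" if "i < d" for i
    using that s_pos[OF that] by (simp add: ys_def s_def[symmetric] real_div_sqrt)
  have unit: "scalar_prod (ys ! i) (ys ! i) = 1" if "i < d" for i
  proof -
    have "scalar_prod (ys ! i) (ys ! i) =
        1 / sqrt (s i) * scalar_prod (Matrix.vec n (a i 0 \<omega>)) (ys ! i)"
      using that by (simp add: ys_def)
    then show ?thesis
      using row_ys[OF that] s_pos[OF that] by simp
  qed
  have "\<alpha>\<^sup>2 * (q\<^sup>2 * real n) ^ d = \<alpha>\<^sup>2 * (\<Prod>i<d. q\<^sup>2 * real n)"
    by simp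
  also have "\<dots> \<le> \<alpha>\<^sup>2 * (\<Prod>i<d. s i)"
    using s by (intro mult_left_mono prod_mono) auto
  also have "(\<Prod>i<d. s i) = (\<Prod>i<d. (scalar_prod (Matrix.vec n (a i 0 \<omega>)) (ys ! i))\<^sup>2)"
    using row_ys s_pos by (intro prod.cong) (auto simp: less_imp_le)
  \<comment> \<open>Only the term of row 0 is kept; the others are nonnegative.\<close>
  also have "\<dots> \<le> (\<Sum>j<m. \<Prod>i<d. (scalar_prod (Matrix.vec n (a i j \<omega>)) (ys ! i))\<^sup>2)"
    using \<open>m > 0\<close>
    by (intro member_le_sum[of 0 "{..<m}"
      "\<lambda>j. \<Prod>i<d. (scalar_prod (Matrix.vec n (a i j \<omega>)) (ys ! i))\<^sup>2"]) (auto intro: prod_nonneg)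
  finally have "\<alpha>\<^sup>2 * (q\<^sup>2 * real n) ^ d \<le>
      \<alpha>\<^sup>2 * (\<Sum>j<m. \<Prod>i<d. (scalar_prod (Matrix.vec n (a i j \<omega>)) (ys ! i))\<^sup>2)"
    by (simp add: mult_left_mono)
  also have "\<dots> \<le> 1 + \<delta>"
    using tensor_rip_kron_list(2)[OF rip _ _ ys unit] assms
    by (simp add: l2_norm_measurement_kron_list ys)
  finally have "\<alpha>\<^sup>2 * (q\<^sup>2 * real n) ^ d \<le> 1 + \<delta>" .
  \<comment> \<open>This factor turns the upper bound 1 + \<delta> into 1 - \<delta>, the left side
    of \<open>lower\<close>; then \<alpha>^2 cancels.\<close>
  then have "(1 - \<delta>) / (1 + \<delta>) * (\<alpha>\<^sup>2 * (q\<^sup>2 * real n) ^ d) \<le> (1 - \<delta>) / (1 + \<delta>) * (1 + \<delta>)"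
    using \<open>0 < \<delta>\<close> \<open>\<delta> < 1\<close> by (intro mult_left_mono) auto
  also have "\<dots> \<le> \<alpha>\<^sup>2 * (\<Sum>j<m. \<Prod>i<d. (a i j \<omega> c)\<^sup>2)"
    using lower \<open>0 < \<delta>\<close> by simp
  finally have "\<alpha>\<^sup>2 * ((1 - \<delta>) / (1 + \<delta>) * (q\<^sup>2 * real n) ^ d) \<le>
      \<alpha>\<^sup>2 * (\<Sum>j<m. \<Prod>i<d. (a i j \<omega> c)\<^sup>2)"
    by (simp add: mult_ac)
  then show ?thesis
    by (rule mult_left_le_imp_le) (use \<open>\<alpha> > 0\<close> in simp)
qed

section \<open>Second moments of sub-Gaussian coordinates\<close>

text \<open>Integrates y \<le> exp y at y = X^2 / s^2 for an admissible \<open>s\<close> below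
  \<open>t\<close>. The strict hypothesis supplies such an \<open>s\<close> whether or not the
  infimum is attained.\<close>

lemma nn_integral_power2_le_subgaussian_norm:
  assumes "X \<in> borel_measurable M" "subgaussian_norm M X < ennreal t" "t > 0"
  shows "(\<integral>\<^sup>+\<omega>. ennreal ((X \<omega>)\<^sup>2) \<partial>M) \<le> ennreal (2 * t\<^sup>2)"
proof -
  obtain s where s: "s > 0" "ennreal s < ennreal t"
    "(\<integral>\<^sup>+\<omega>. ennreal (exp ((X \<omega>)\<^sup>2 / s\<^sup>2)) \<partial>M) \<le> 2"
    using assms(2) unfolding subgaussian_norm_def Inf_less_iff by auto
  have "s < t"
    using s by (simp add: ennreal_less_iff)
  have "(X \<omega>)\<^sup>2 \<le> s\<^sup>2 * exp ((X \<omega>)\<^sup>2 / s\<^sup>2)" for \<omega>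
  proof -
    have "(X \<omega>)\<^sup>2 / s\<^sup>2 \<le> exp ((X \<omega>)\<^sup>2 / s\<^sup>2)"
      using exp_ge_add_one_self[of "(X \<omega>)\<^sup>2 / s\<^sup>2"] by linarith
    then show ?thesis
      using \<open>s > 0\<close> by (simp add: divide_le_eq mult.commute)
  qed
  then have "(\<integral>\<^sup>+\<omega>. ennreal ((X \<omega>)\<^sup>2) \<partial>M) \<le>
      (\<integral>\<^sup>+\<omega>. ennreal (s\<^sup>2) * ennreal (exp ((X \<omega>)\<^sup>2 / s\<^sup>2)) \<partial>M)"
    by (intro nn_integral_mono) (simp flip: ennreal_mult)
  also have "\<dots> = ennreal (s\<^sup>2) * (\<integral>\<^sup>+\<omega>. ennreal (exp ((X \<omega>)\<^sup>2 / s\<^sup>2)) \<partial>M)"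
    using assms(1) by (intro nn_integral_cmult) simp
  also have "\<dots> \<le> ennreal (s\<^sup>2) * 2"
    using s by (intro mult_left_mono) auto
  also have "\<dots> = ennreal (2 * s\<^sup>2)"
    by (simp add: ennreal_mult mult.commute)
  also have "\<dots> \<le> ennreal (2 * t\<^sup>2)"
    using \<open>s < t\<close> \<open>s > 0\<close> by (intro ennreal_leI) (simp add: power_mono)
  finally show ?thesis .
qed

text \<open>A coordinate is the scalar product with a standard unit vector, so its sub-Gaussian norm
  is at most \<open>l\<close>. The constant is 2 t^2 at t = 2 l, where doubling provides the strict
  inequality needed for the moment bound.\<close>

lemma admissible_distribution_second_moment:
  assumes "admissible_distribution l q n D" "c < n" "l > 0"
  shows "(\<integral>\<^sup>+x. ennreal ((x c)\<^sup>2) \<partial>D) \<le> ennreal (8 * l\<^sup>2)"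
proof -
  have sets: "sets D = sets (borel_vec n)"
    and norm: "subgaussian_norm_vec n D \<le> ennreal l"
    using assms(1) by (auto simp: admissible_distribution_def)
  let ?u = "\<lambda>i. if i = c then 1 else 0 :: real"
  have coord: "(\<Sum>i<n. x i * ?u i) = x c" for x :: "nat \<Rightarrow> real"
    using \<open>c < n\<close> by (simp add: if_distrib cong: if_cong)
  have "(\<Sum>i<n. (?u i)\<^sup>2) = 1"
    using \<open>c < n\<close> by (simp add: if_distrib[of "\<lambda>x. x\<^sup>2"] cong: if_cong)
  then have "L2_set ?u {..<n} = 1"
    by (simp add: L2_set_def)
  then have "subgaussian_norm D (\<lambda>x. \<Sum>i<n. x i * ?u i) \<le> subgaussian_norm_vec n D"
    unfolding subgaussian_norm_vec_def by (intro SUP_upper) simp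
  then have "subgaussian_norm D (\<lambda>x. x c) \<le> ennreal l"
    using norm unfolding coord by (rule order_trans)
  also have "\<dots> < ennreal (2 * l)"
    using \<open>l > 0\<close> by (simp add: ennreal_less_iff)
  finally have "subgaussian_norm D (\<lambda>x. x c) < ennreal (2 * l)" .
  moreover have "(\<lambda>x. x c) \<in> borel_measurable D"
    using \<open>c < n\<close> by (simp cong: measurable_cong_sets add: measurable_cong_sets[OF sets refl])
  ultimately show ?thesis
    using nn_integral_power2_le_subgaussian_norm[of "\<lambda>x. x c" D "2 * l"] \<open>l > 0\<close>
    by (simp add: power_mult_distrib)
qed

section \<open>Random rows and Markov's inequality\<close>

lemma iid_rows_measurable:
  assumes "prob_space M" "iid_rows d n M D a" "i < d"
  shows "a i k \<in> measurable M (borel_vec n)"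
proof -
  interpret prob_space M by fact
  show ?thesis
    using assms(2,3) unfolding iid_rows_def indep_vars_def by force
qed

text \<open>The product takes the row with the same index \<open>j\<close> from each of the
  \<open>d\<close> factors. These rows are independent, so the expectation factors into
  \<open>d\<close> second moments.\<close>

lemma nn_integral_row_product_le:
  assumes M: "prob_space M" and rows: "iid_rows d n M D a"
    and D: "admissible_distribution l q n D" and "c < n" "l > 0"
  shows "(\<integral>\<^sup>+\<omega>. ennreal (\<Prod>i<d. (a i j \<omega> c)\<^sup>2) \<partial>M) \<le> ennreal ((8 * l\<^sup>2) ^ d)"
proof -
  interpret prob_space M by fact
  \<comment> \<open>Independence is indexed by pairs (factor, row), so products over the factors are
    read as products over the slice \<open>{..<d} \<times> {j}\<close>.\<close>
  have reindex: "(\<Prod>p\<in>{..<d} \<times> {j}. f p) = (\<Prod>i<d. f (i, j))"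
    for f :: "nat \<times> nat \<Rightarrow> ennreal"
    by (rule prod.reindex_bij_witness[of _ "\<lambda>i. (i, j)" fst]) auto
  have sq_meas: "(\<lambda>x. ennreal ((x c)\<^sup>2)) \<in> measurable (borel_vec n) borel"
    using measurable_component_singleton[of c "{..<n}" "\<lambda>_. borel"] \<open>c < n\<close> by simp
  have "indep_vars (\<lambda>_. borel_vec n) (\<lambda>(i, k). a i k) ({..<d} \<times> {j})"
    using rows unfolding iid_rows_def by (auto intro: indep_vars_subset)
  then have indep: "indep_vars (\<lambda>_. borel) (\<lambda>p \<omega>. ennreal (((case p of (i, k) \<Rightarrow> a i k) \<omega> c)\<^sup>2))
      ({..<d} \<times> {j})"
    by (rule indep_vars_compose2[where Y = "\<lambda>_ x. ennreal ((x c)\<^sup>2)"]) (rule sq_meas)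
  have moment: "(\<integral>\<^sup>+\<omega>. ennreal ((a i j \<omega> c)\<^sup>2) \<partial>M) \<le> ennreal (8 * l\<^sup>2)" if "i < d" for i
  proof -
    have "(\<integral>\<^sup>+\<omega>. ennreal ((a i j \<omega> c)\<^sup>2) \<partial>M) =
        (\<integral>\<^sup>+x. ennreal ((x c)\<^sup>2) \<partial>distr M (borel_vec n) (a i j))"
      by (subst nn_integral_distr[OF iid_rows_measurable[OF M rows that]]) (simp_all add: sq_meas)
    also have "distr M (borel_vec n) (a i j) = D"
      using rows that by (auto simp: iid_rows_def)
    also have "(\<integral>\<^sup>+x. ennreal ((x c)\<^sup>2) \<partial>D) \<le> ennreal (8 * l\<^sup>2)"
      using admissible_distribution_second_moment D \<open>c < n\<close> \<open>l > 0\<close> by blast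
    finally show ?thesis .
  qed
  have "(\<integral>\<^sup>+\<omega>. ennreal (\<Prod>i<d. (a i j \<omega> c)\<^sup>2) \<partial>M) =
      (\<integral>\<^sup>+\<omega>. (\<Prod>p\<in>{..<d} \<times> {j}. ennreal (((case p of (i, k) \<Rightarrow> a i k) \<omega> c)\<^sup>2)) \<partial>M)"
    by (simp add: reindex prod_ennreal)
  also have "\<dots> = (\<Prod>p\<in>{..<d} \<times> {j}. \<integral>\<^sup>+\<omega>. ennreal (((case p of (i, k) \<Rightarrow> a i k) \<omega> c)\<^sup>2) \<partial>M)"
    by (rule indep_vars_nn_integral[OF _ indep]) auto
  also have "\<dots> = (\<Prod>i<d. \<integral>\<^sup>+\<omega>. ennreal ((a i j \<omega> c)\<^sup>2) \<partial>M)"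
    by (simp add: reindex)
  also have "\<dots> \<le> (\<Prod>i<d. ennreal (8 * l\<^sup>2))"
    using moment by (intro prod_mono_ennreal) auto
  also have "\<dots> = ennreal ((8 * l\<^sup>2) ^ d)"
    by (simp add: ennreal_power)
  finally show ?thesis .
qed

text \<open>Linearity bounds the expectation of the sum by \<open>N\<close> times the bound for one
  row, and Markov's inequality follows. Measurability is recorded because this event later serves as
  the larger one in a comparison of probabilities.\<close>

lemma prob_sum_row_products_ge:
  assumes M: "prob_space M" and rows: "iid_rows d n M D a"
    and D: "admissible_distribution l q n D" and "c < n" "l > 0" "t > 0"
  shows "{\<omega> \<in> space M. t \<le> (\<Sum>j<N. \<Prod>i<d. (a i j \<omega> c)\<^sup>2)} \<in> sets M"
    and "\<P>(\<omega> in M. t \<le> (\<Sum>j<N. \<Prod>i<d. (a i j \<omega> c)\<^sup>2)) \<le> real N * (8 * l\<^sup>2) ^ d / t"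
proof -
  interpret prob_space M by fact
  let ?S = "\<lambda>\<omega>. \<Sum>j<N. \<Prod>i<d. (a i j \<omega> c)\<^sup>2"
  have entry: "(\<lambda>\<omega>. a i j \<omega> c) \<in> borel_measurable M" if "i < d" for i j
    using measurable_compose[OF iid_rows_measurable[OF M rows that]
      measurable_component_singleton[of c "{..<n}" "\<lambda>_. borel"]] \<open>c < n\<close> by simp
  have prod: "(\<lambda>\<omega>. \<Prod>i<d. (a i j \<omega> c)\<^sup>2) \<in> borel_measurable M" for j
    by (intro borel_measurable_prod borel_measurable_power entry) simp
  then have S: "?S \<in> borel_measurable M"
    by (intro borel_measurable_sum)
  then show "{\<omega> \<in> space M. t \<le> ?S \<omega>} \<in> sets M"
    by measurable
  have "(\<integral>\<^sup>+\<omega>. ennreal (?S \<omega>) \<partial>M) = (\<Sum>j<N. \<integral>\<^sup>+\<omega>. ennreal (\<Prod>i<d. (a i j \<omega> c)\<^sup>2) \<partial>M)"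
    using prod by (subst nn_integral_sum[symmetric]) (auto simp: sum_ennreal prod_nonneg)
  also have "\<dots> \<le> (\<Sum>j<N. ennreal ((8 * l\<^sup>2) ^ d))"
    by (intro sum_mono nn_integral_row_product_le[OF M rows D \<open>c < n\<close> \<open>l > 0\<close>])
  also have "\<dots> = ennreal (real N * (8 * l\<^sup>2) ^ d)"
    by (simp add: ennreal_mult ennreal_of_nat_eq_real_of_nat)
  finally have ES: "(\<integral>\<^sup>+\<omega>. ennreal (?S \<omega>) \<partial>M) \<le> ennreal (real N * (8 * l\<^sup>2) ^ d)" .
  \<comment> \<open>Markov's inequality is applied with threshold 1, so the level \<open>t\<close>
    becomes the constant 1/t.\<close>
  have "{\<omega> \<in> space M. t \<le> ?S \<omega>} = {\<omega> \<in> space M. 1 \<le> ennreal (1 / t) * ennreal (?S \<omega>)}"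
    using \<open>t > 0\<close> by (auto simp: sum_nonneg prod_nonneg simp flip: ennreal_mult ennreal_1)
  then have "emeasure M {\<omega> \<in> space M. t \<le> ?S \<omega>} \<le>
      ennreal (1 / t) * (\<integral>\<^sup>+\<omega>. ennreal (?S \<omega>) * indicator (space M) \<omega> \<partial>M)"
    using S nn_integral_Markov_inequality[of "\<lambda>\<omega>. ennreal (?S \<omega>)" "space M" M "ennreal (1 / t)"]
    by simp
  also have "(\<integral>\<^sup>+\<omega>. ennreal (?S \<omega>) * indicator (space M) \<omega> \<partial>M) = (\<integral>\<^sup>+\<omega>. ennreal (?S \<omega>) \<partial>M)"
    by (intro nn_integral_cong) simp
  also have "ennreal (1 / t) * \<dots> \<le> ennreal (1 / t) * ennreal (real N * (8 * l\<^sup>2) ^ d)"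
    by (intro mult_left_mono ES) simp
  also have "\<dots> = ennreal (real N * (8 * l\<^sup>2) ^ d / t)"
    using \<open>t > 0\<close> by (simp flip: ennreal_mult)
  finally show "\<P>(\<omega> in M. t \<le> ?S \<omega>) \<le> real N * (8 * l\<^sup>2) ^ d / t"
    using \<open>t > 0\<close> by (simp add: emeasure_eq_measure)
qed

text \<open>The bound passes from \<open>D\<close> to each row through its distribution; the
  exceptional null sets, indexed by \<open>i\<close> and \<open>c\<close>, form a countable
  family.\<close>

lemma AE_iid_rows_bounded_below:
  assumes M: "prob_space M" and rows: "iid_rows d n M D a"
    and D: "admissible_distribution l q n D"
  shows "AE \<omega> in M. \<forall>i<d. \<forall>c<n. \<bar>a i k \<omega> c\<bar> > q"
proof -
  have "AE \<omega> in M. \<bar>a i k \<omega> c\<bar> > q" if "i < d" "c < n" for i c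
  proof (rule AE_distrD[OF iid_rows_measurable[OF M rows \<open>i < d\<close>]])
    show "AE x in distr M (borel_vec n) (a i k). \<bar>x c\<bar> > q"
      using rows D that unfolding iid_rows_def admissible_distribution_def by metis
  qed
  then show ?thesis
    by (intro AE_all_countable[THEN iffD2] allI AE_impI)
qed

section \<open>Probability bound and limit\<close>

text \<open>Since the sum of row products increases with \<open>m\<close> and its lower bound does
  not involve \<alpha>, a single event covers every \<open>m\<close> and every \<alpha> at once,
  without a union bound.\<close>

lemma prob_tensor_rip_le:
  fixes a :: "nat \<Rightarrow> nat \<Rightarrow> 'a \<Rightarrow> nat \<Rightarrow> real"
  assumes M: "prob_space M" and rows: "iid_rows d n M D a"
    and D: "admissible_distribution l q n D"
    and "d > 0" "r > 0" "l > 0" "q > 0" "0 < \<delta>" "\<delta> < 1" "n > 0" "x \<ge> 0"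
  shows "\<P>(\<omega> in M. \<exists>m \<alpha>. real m < x \<and> \<alpha> > 0 \<and>
      tensor_rip \<delta> r n d (\<alpha> \<cdot>\<^sub>m measurement_matrix d n m a \<omega>)) \<le>
    (1 + \<delta>) / (1 - \<delta>) * (8 * l\<^sup>2 / q\<^sup>2) ^ d * (x / real n ^ d)"
proof -
  interpret prob_space M by fact
  define t where "t = (1 - \<delta>) / (1 + \<delta>) * (q\<^sup>2 * real n) ^ d"
  have "t > 0"
    using assms by (simp add: t_def)
  \<comment> \<open>For integer \<open>x\<close> this exceeds the largest admissible
    \<open>m\<close> by one, which is harmless: the argument needs that m < x implies m \<le> N, and
    that N \<le> x.\<close>
  define N where "N = nat \<lfloor>x\<rfloor>"
  have "AE \<omega> in M. (\<exists>m \<alpha>. real m < x \<and> \<alpha> > 0 \<and>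
      tensor_rip \<delta> r n d (\<alpha> \<cdot>\<^sub>m measurement_matrix d n m a \<omega>)) \<longrightarrow>
      t \<le> (\<Sum>j<N. \<Prod>i<d. (a i j \<omega> 0)\<^sup>2)"
    using AE_iid_rows_bounded_below[OF M rows D, of 0]
  proof (eventually_elim, intro impI, elim exE conjE)
    fix \<omega> m \<alpha>
    assume "\<forall>i<d. \<forall>c<n. q < \<bar>a i 0 \<omega> c\<bar>" "real m < x" "\<alpha> > 0"
      "tensor_rip \<delta> r n d (\<alpha> \<cdot>\<^sub>m measurement_matrix d n m a \<omega>)"
    then have "t \<le> (\<Sum>j<m. \<Prod>i<d. (a i j \<omega> 0)\<^sup>2)"
      unfolding t_def using assms by (intro tensor_rip_measurement_matrix_lower_bound[where r = r and \<alpha> = \<alpha>]) auto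
    also have "\<dots> \<le> (\<Sum>j<N. \<Prod>i<d. (a i j \<omega> 0)\<^sup>2)"
      using \<open>real m < x\<close> by (intro sum_mono2) (auto simp: N_def prod_nonneg dest!: less_imp_le[THEN le_nat_floor])
    finally show "t \<le> (\<Sum>j<N. \<Prod>i<d. (a i j \<omega> 0)\<^sup>2)" .
  qed
  \<comment> \<open>The RIP event is not shown to be measurable. Monotonicity asks this only of the
    larger event, since a non-measurable set has measure 0 by convention.\<close>
  then have "\<P>(\<omega> in M. \<exists>m \<alpha>. real m < x \<and> \<alpha> > 0 \<and>
      tensor_rip \<delta> r n d (\<alpha> \<cdot>\<^sub>m measurement_matrix d n m a \<omega>)) \<le>
      \<P>(\<omega> in M. t \<le> (\<Sum>j<N. \<Prod>i<d. (a i j \<omega> 0)\<^sup>2))"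
    using prob_sum_row_products_ge(1)[OF M rows D \<open>n > 0\<close> \<open>l > 0\<close> \<open>t > 0\<close>]
    by (intro finite_measure_mono_AE) auto
  also have "\<dots> \<le> real N * (8 * l\<^sup>2) ^ d / t"
    by (rule prob_sum_row_products_ge(2)[OF M rows D \<open>n > 0\<close> \<open>l > 0\<close> \<open>t > 0\<close>])
  also have "\<dots> \<le> x * (8 * l\<^sup>2) ^ d / t"
    using \<open>t > 0\<close> \<open>x \<ge> 0\<close> by (intro divide_right_mono mult_right_mono) (auto simp: N_def)
  also have "\<dots> = (1 + \<delta>) / (1 - \<delta>) * (8 * l\<^sup>2 / q\<^sup>2) ^ d * (x / real n ^ d)"
    unfolding t_def power_mult_distrib power_divide by (simp add: mult_ac)
  finally show ?thesis .
qed

theorem proposition1: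
  fixes d r :: nat and l q \<delta> \<phi> :: real
    and D :: "nat \<Rightarrow> (nat \<Rightarrow> real) measure"
    and M :: "nat \<Rightarrow> 'a measure"
    and a :: "nat \<Rightarrow> nat \<Rightarrow> nat \<Rightarrow> 'a \<Rightarrow> nat \<Rightarrow> real"
  assumes "d > 0" and "r > 0" and "l > 0" and "q > 0"
    and "0 < \<delta>" and "\<delta> < 1" and "0 < \<phi>" and "\<phi> < 1 / 2"
    and "\<And>n. n > 0 \<Longrightarrow> admissible_distribution l q n (D n)"
    and "\<And>n. n > 0 \<Longrightarrow> prob_space (M n)"
    and "\<And>n. n > 0 \<Longrightarrow> iid_rows d n (M n) (D n) (a n)"
  shows "(\<lambda>n. \<P>(\<omega> in M n. \<exists>m \<alpha>. real m < real n powr (real d * (1 - \<phi>)) \<and> \<alpha> > 0 \<and>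
            tensor_rip \<delta> r n d (\<alpha> \<cdot>\<^sub>m measurement_matrix d n m (a n) \<omega>)))
         \<longlonglongrightarrow> 0"
proof -
  define K where "K = (1 + \<delta>) / (1 - \<delta>) * (8 * l\<^sup>2 / q\<^sup>2) ^ d"
  let ?P = "\<lambda>n. \<P>(\<omega> in M n. \<exists>m \<alpha>. real m < real n powr (real d * (1 - \<phi>)) \<and> \<alpha> > 0 \<and>
            tensor_rip \<delta> r n d (\<alpha> \<cdot>\<^sub>m measurement_matrix d n m (a n) \<omega>))"
  have upper: "?P n \<le> K * real n powr (- (real d * \<phi>))" if "n > 0" for n
  proof -
    have "?P n \<le> K * (real n powr (real d * (1 - \<phi>)) / real n ^ d)"
      unfolding K_def using assms that by (intro prob_tensor_rip_le) auto
    \<comment> \<open>As n > 0, the denominator is also a \<open>powr\<close>, and the exponents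
      subtract to d (1 - \<phi>) - d = - d \<phi>.\<close>
    also have "real n powr (real d * (1 - \<phi>)) / real n ^ d = real n powr (- (real d * \<phi>))"
      using that by (simp flip: powr_realpow powr_diff add: algebra_simps)
    finally show ?thesis .
  qed
  have "(\<lambda>n. real n powr (- (real d * \<phi>))) \<longlonglongrightarrow> 0"
    using assms(1,7) by (intro tendsto_neg_powr filterlim_real_sequentially) simp
  then have lim: "(\<lambda>n. K * real n powr (- (real d * \<phi>))) \<longlonglongrightarrow> 0"
    by (rule tendsto_mult_right_zero)
  show ?thesis
  \<comment> \<open>The lower side is nonnegativity of probabilities. The upper side is only
    eventual because \<open>upper\<close> excludes n = 0.\<close>
  proof (rule tendsto_sandwich[OF _ _ tendsto_const lim])
    show "\<forall>\<^sub>F n in sequentially. ?P n \<le> K * real n powr (- (real d * \<phi>))"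
      using eventually_gt_at_top[of 0] by eventually_elim (rule upper)
  qed simp
qed

end
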